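(* Let $G$ be any graph without isolated vertices. Then $$\tilde{r}(P_7,G)\ge \tfrac{8}{5}v(G)-v_1(G),\qquad \tilde{r}(P_8,G)\ge \tfrac{18}{11}v(G)-v_1(G),\qquad \tilde{r}(P_9,G)\ge \tfrac{5}{3}v(G)-v_1(G),$$ where $v(G)$ is the number of vertices of $G$ and $v_1(G)$ is the number of vertices of degree $1$ in $G$.
   Context: $P_k$ denotes the path on $k$ vertices. For graphs $H_1,H_2$, the online Ramsey game is played on the edge set of the infinite complete graph $K_{\mathbb N}$ (vertex set $\mathbb N$), starting with no colored edges. In every round Builder selects a previously unselected edge and Painter colors it red or blue. The game ends as soon as, after a move of Painter, there is a red copy of $H_1$ or a blue copy of $H_2$. Builder tries to end the game as soon as possible, Painter tries to delay it. The online size Ramsey number $\tilde{r}(H_1,H_2)$ is the number of rounds of the game when both players play optimally. *)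

theory Defs
  imports "HOL-Library.Extended_Real"
begin

record 'a ugraph =
  vertex_set :: "'a set"
  edge_set :: "'a set set"

definition finite_simple_graph :: "'a ugraph \<Rightarrow> bool" where
  "finite_simple_graph G \<longleftrightarrow>
     finite (vertex_set G) \<and> (\<forall>e\<in>edge_set G. e \<subseteq> vertex_set G \<and> card e = 2)"

definition vertex_degree :: "'a ugraph \<Rightarrow> 'a \<Rightarrow> nat" where
  "vertex_degree G v = card {e \<in> edge_set G. v \<in> e}"

definition no_isolated_vertices :: "'a ugraph \<Rightarrow> bool" where
  "no_isolated_vertices G \<longleftrightarrow> (\<forall>v\<in>vertex_set G. vertex_degree G v \<noteq> 0)"

definition num_vertices :: "'a ugraph \<Rightarrow> nat" where
  "num_vertices G = card (vertex_set G)"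

definition num_degree_one :: "'a ugraph \<Rightarrow> nat" where
  "num_degree_one G = card {v \<in> vertex_set G. vertex_degree G v = 1}"

text \<open>The subscript of a path counts vertices: \<open>path_graph k\<close> has \<open>k - 1\<close> edges.\<close>

definition path_graph :: "nat \<Rightarrow> nat ugraph" where
  "path_graph k = \<lparr>vertex_set = {0..<k}, edge_set = {{i, Suc i} | i. Suc i < k}\<rparr>"

definition complete_edges :: "nat set set" where
  "complete_edges = {e. card e = 2}"

text \<open>Copies are subgraphs that need not be induced.\<close>

definition contains_copy :: "'a ugraph \<Rightarrow> nat set set \<Rightarrow> bool" where
  "contains_copy H F \<longleftrightarrow>
     (\<exists>f :: 'a \<Rightarrow> nat. inj_on f (vertex_set H) \<and> (\<forall>e\<in>edge_set H. f ` e \<in> F))"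

datatype edge_color = Red | Blue

type_synonym history = "(nat set \<times> edge_color) list"

definition selected_edges :: "history \<Rightarrow> nat set set" where
  "selected_edges h = fst ` set h"

definition color_class :: "edge_color \<Rightarrow> history \<Rightarrow> nat set set" where
  "color_class c h = {e. (e, c) \<in> set h}"

definition game_over :: "'a ugraph \<Rightarrow> 'b ugraph \<Rightarrow> history \<Rightarrow> bool" where
  "game_over H1 H2 h \<longleftrightarrow>
     contains_copy H1 (color_class Red h) \<or> contains_copy H2 (color_class Blue h)"

type_synonym builder_strategy = "history \<Rightarrow> nat set"
type_synonym painter_strategy = "history \<Rightarrow> nat set \<Rightarrow> edge_color"

text \<open>A history is finite, so Builder always has an unselected edge available.\<close>

definition legal_builder :: "builder_strategy \<Rightarrow> bool" where
  "legal_builder \<sigma> \<longleftrightarrow> (\<forall>h. \<sigma> h \<in> complete_edges - selected_edges h)"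

text \<open>
  The play is continued past the end of the game; only its first position
  that ends the game matters in \<open>game_length\<close>.
\<close>

primrec play_history :: "builder_strategy \<Rightarrow> painter_strategy \<Rightarrow> nat \<Rightarrow> history" where
  "play_history \<sigma> \<tau> 0 = []"
| "play_history \<sigma> \<tau> (Suc n) =
     (let h = play_history \<sigma> \<tau> n; e = \<sigma> h in h @ [(e, \<tau> h e)])"

text \<open>The length is \<open>\<infinity>\<close> (the infimum of the empty set) if the game never ends.\<close>

definition game_length ::
  "'a ugraph \<Rightarrow> 'b ugraph \<Rightarrow> builder_strategy \<Rightarrow> painter_strategy \<Rightarrow> enat" where
  "game_length H1 H2 \<sigma> \<tau> =
     (INF n\<in>{n. game_over H1 H2 (play_history \<sigma> \<tau> n)}. enat n)"

definition online_size_ramsey :: "'a ugraph \<Rightarrow> 'b ugraph \<Rightarrow> enat" where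
  "online_size_ramsey H1 H2 =
     (INF \<sigma>\<in>{\<sigma>. legal_builder \<sigma>}. SUP \<tau>. game_length H1 H2 \<sigma> \<tau>)"

end

(*
  Painter keeps every red component inside a rooted pattern: a core (one red edge if only P_6 may
  appear, a red P_3 if P_7 may appear), leaves hanging from the core, and tips hanging from leaves;
  other vertices are red-isolated or lie in a red K_2.  Isolated vertices are joined in red to the
  core and to K_2's.  An isolated vertex with no earlier blue edge to a leaf gets a blue edge to a
  leaf, otherwise a red one, which makes it a tip; its edges to tips are blue.  Hence a vertex that
  stays isolated has at most one blue edge to a leaf, all its others go to tips, and every tip has
  already spent one of its blue edges when it is created.  An edge from a vertex of a K_2 to the core
  is red only when the other vertex of the K_2 already has a blue edge and the K_2 has two of them,
  so a surviving K_2 can use at most two blue edges to cores.  Two K_2's are joined in red into a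
  core with leaves; all remaining edges are blue.

  Counting is by discharging along the blue edges drawn from an isolated vertex or a K_2 to a larger
  component: leaves pay 1/2 and tips pay l/2 to the other end.  With l = 5 (edge core) or l = 3
  (P_3 core) this gives at least (3l+1)/(2l) v(G) - v_1(G) rounds.  The P_3 core yields 5/3 without
  a red P_8, so it settles P_8 and P_9 together.
*)
theory Submission
  imports Defs
begin

section \<open>Roles of vertices, their heights, credits and tolls\<close>

text \<open>
  \<^item> \<open>Pair\<close>: vertex of a red $K_2$; \<open>Center\<close> is the middle vertex of a $P_3$ core and does not
    occur when the core is an edge.
  \<^item> \<open>SLeaf\<close>, \<open>STip\<close>: a leaf and a tip that came from a common $K_2$, both with earlier blue edges;
    the leaf lends part of its surplus to the tip (see \<open>credit\<close>).
\<close>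

datatype role = Iso | Pair | Center | Base | Leaf | SLeaf | Tip | STip

text \<open>Heights fall from the core outward to the tips. The last clause includes
  \<open>Pair\<close>: the least height makes \<open>par\<close> the only red neighbour.\<close>

fun height :: "role \<Rightarrow> nat" where
  "height Center = 3"
| "height Base = 2"
| "height Leaf = 1"
| "height SLeaf = 1"
| "height _ = 0"

fun small :: "role \<Rightarrow> bool" where
  "small Iso = True"
| "small Pair = True"
| "small _ = False"

fun core :: "role \<Rightarrow> bool" where
  "core Center = True"
| "core Base = True"
| "core _ = False"

fun leafy :: "role \<Rightarrow> bool" where
  "leafy Leaf = True"
| "leafy SLeaf = True"
| "leafy _ = False"

definition outer :: "role \<Rightarrow> bool" where
  "outer r \<longleftrightarrow> \<not> small r \<and> \<not> core r"

text \<open>All amounts of the discharging argument are doubled, to stay in the integers.\<close>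

fun credit :: "int \<Rightarrow> role \<Rightarrow> int" where
  "credit l Iso = 0"
| "credit l Pair = l"
| "credit l Center = l + 1"
| "credit l Base = l + 1"
| "credit l Leaf = l + 3"
| "credit l SLeaf = l + 2"
| "credit l Tip = 2 * l"
| "credit l STip = 2 * l + 1"

fun toll :: "int \<Rightarrow> role \<Rightarrow> int" where
  "toll l Leaf = 1"
| "toll l SLeaf = 1"
| "toll l Tip = l"
| "toll l STip = l"
| "toll l _ = 0"

definition total_credit :: "int \<Rightarrow> (nat \<Rightarrow> role) \<Rightarrow> int" where
  "total_credit l role = (\<Sum>v | role v \<noteq> Iso. credit l (role v))"

lemma total_credit_superset:
  assumes "finite S" "{v. role v \<noteq> Iso} \<subseteq> S"
  shows "total_credit l role = (\<Sum>v\<in>S. credit l (role v))"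
  unfolding total_credit_def
  by (rule sum.mono_neutral_left) (use assms in auto)

definition finitely_used :: "(nat \<Rightarrow> role) \<Rightarrow> bool" where
  "finitely_used role \<longleftrightarrow> finite {v. role v \<noteq> Iso}"

lemma finitely_used_upd: "finitely_used role \<Longrightarrow> finitely_used (role(u := r))"
  unfolding finitely_used_def
  by (rule finite_subset[of _ "insert u {v. role v \<noteq> Iso}"]) auto

lemma total_credit_upd:
  assumes "finitely_used role"
  shows "total_credit l (role(u := r)) = total_credit l role + credit l r - credit l (role u)"
proof -
  let ?S = "insert u {v. role v \<noteq> Iso}"
  have S: "finite ?S" using assms by (simp add: finitely_used_def)
  have "total_credit l (role(u := r)) = (\<Sum>v\<in>?S. credit l ((role(u := r)) v))"
    by (rule total_credit_superset) (use S in auto)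
  also have "\<dots> = credit l r + (\<Sum>v\<in>?S - {u}. credit l (role v))"
    using S by (subst sum.remove[of _ u]) auto
  also have "(\<Sum>v\<in>?S - {u}. credit l (role v)) = (\<Sum>v\<in>?S. credit l (role v)) - credit l (role u)"
    using S by (subst (2) sum.remove[of _ u]) auto
  also have "(\<Sum>v\<in>?S. credit l (role v)) = total_credit l role"
    by (rule total_credit_superset[symmetric]) (use S in auto)
  finally show ?thesis by (simp del: fun_upd_apply)
qed

section \<open>The red graph: labels and credit under a new red edge\<close>

text \<open>\<open>red_not_iso\<close>, \<open>par_eq\<close> and \<open>flat\<close> from the
  invariant below, for one ordered edge, so that an edge can be checked against new labels in one
  go.\<close>

definition fits :: "int \<Rightarrow> (nat \<Rightarrow> role) \<Rightarrow> (nat \<Rightarrow> nat) \<Rightarrow> nat \<Rightarrow> nat \<Rightarrow> bool" where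
  "fits l role par x y \<longleftrightarrow> role x \<noteq> Iso
    \<and> (height (role x) \<le> height (role y) \<longrightarrow> par x = y)
    \<and> (height (role x) = height (role y) \<longrightarrow> l = 5 \<or> height (role x) = 0)"

text \<open>
  By \<open>par_eq\<close>, heights along a red path have no interior local minimum, which bounds the length of
  the path. On a pair, \<open>par\<close> exchanges the two vertices.
\<close>

locale red_state =
  fixes l :: int and role :: "nat \<Rightarrow> role" and par :: "nat \<Rightarrow> nat" and R :: "nat set set"
  assumes l: "l = 3 \<or> l = 5"
    and used: "finitely_used role"
    and finite_red: "finite R"
    and card_red: "e \<in> R \<Longrightarrow> card e = 2"
    and red_not_iso: "{x, y} \<in> R \<Longrightarrow> role x \<noteq> Iso"
    and par_eq: "{x, y} \<in> R \<Longrightarrow> height (role x) \<le> height (role y) \<Longrightarrow> par x = y"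
    and flat: "{x, y} \<in> R \<Longrightarrow> height (role x) = height (role y) \<Longrightarrow> l = 5 \<or> height (role x) = 0"
    and no_center: "l = 5 \<Longrightarrow> role x \<noteq> Center"
    and pair_red: "role x = Pair \<Longrightarrow> {x, par x} \<in> R"
    and pair_par: "role x = Pair \<Longrightarrow> role (par x) = Pair"
    and credit_le: "total_credit l role \<le> 2 * l * int (card R)"
begin

lemma par_par: "role x = Pair \<Longrightarrow> par (par x) = x"
  using pair_red pair_par par_eq[of "par x" x] by (simp add: insert_commute)

lemma par_neq: "role x = Pair \<Longrightarrow> par x \<noteq> x"
  using pair_red card_red by fastforce

text \<open>A pair has height 0, so \<open>par_eq\<close> applies to each of its red edges.\<close>

lemma red_pair: "role x = Pair \<Longrightarrow> {x, y} \<in> R \<longleftrightarrow> y = par x"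
  using pair_red par_eq by force

lemma red_iso: "role x = Iso \<Longrightarrow> {x, y} \<notin> R" "role x = Iso \<Longrightarrow> {y, x} \<notin> R"
  using red_not_iso by (metis insert_commute)+

lemma credit_insert:
  assumes "e \<notin> R" "total_credit l role' \<le> total_credit l role + 2 * l"
  shows "total_credit l role' \<le> 2 * l * int (card (insert e R))"
  using assms credit_le finite_red by (simp add: algebra_simps)

text \<open>Common frame of all red moves. \<open>Z\<close> is a union of red components with at
  most two vertices, so an old red edge either is a pair inside \<open>Z\<close> or has both ends
  outside, where nothing changes. A red edge has a budget of \<open>2 * l\<close> of credit.\<close>

lemma extend:
  assumes new: "{u, v} \<notin> R" "u \<noteq> v"
    and unchanged: "\<And>x. x \<notin> Z \<Longrightarrow> role' x = role x \<and> par' x = par x"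
    and Z_small: "\<And>x. x \<in> Z \<Longrightarrow> small (role x)"
    and Z_par: "\<And>x. x \<in> Z \<Longrightarrow> role x = Pair \<Longrightarrow> par x \<in> Z"
    and new_edge: "fits l role' par' u v" "fits l role' par' v u"
    and old_pair: "\<And>x. x \<in> Z \<Longrightarrow> role x = Pair \<Longrightarrow> fits l role' par' x (par x)"
    and new_pair: "\<And>x. x \<in> Z \<Longrightarrow> role' x = Pair \<Longrightarrow>
      {x, par' x} = {u, v} \<and> role' (par' x) = Pair"
    and cent: "\<And>x. x \<in> Z \<Longrightarrow> l = 5 \<Longrightarrow> role' x \<noteq> Center"
    and used': "finitely_used role'"
    and cred: "total_credit l role' \<le> total_credit l role + 2 * l"
  shows "red_state l role' par' (insert {u, v} R)"
proof -
  have old: "fits l role' par' x y" if "{x, y} \<in> R" for x y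
  proof (cases "x \<in> Z")
    case True
    have "role x = Pair"
      using Z_small[OF True] red_not_iso[OF that] by (cases "role x") auto
    then show ?thesis using red_pair that old_pair[OF True] by simp
  next
    case False
    have "y \<notin> Z"
    proof
      assume y: "y \<in> Z"
      have "{y, x} \<in> R" using that by (simp add: insert_commute)
      then have "role y = Pair"
        using Z_small[OF y] red_not_iso by (cases "role y") force+
      then show False
        using Z_par[OF y] False red_pair[of y x] \<open>{y, x} \<in> R\<close> by simp
    qed
    then show ?thesis
      using False unchanged red_not_iso[OF that] par_eq[OF that] flat[OF that]
      by (simp add: fits_def)
  qed
  have all: "fits l role' par' x y" if "{x, y} \<in> insert {u, v} R" for x y
    using that old new_edge by (auto simp: doubleton_eq_iff)
  show ?thesis
  proof
    show "total_credit l role' \<le> 2 * l * int (card (insert {u, v} R))"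
      using credit_insert[OF new(1) cred] .
    show "role' x \<noteq> Center" if "l = 5" for x
      using that cent no_center unchanged by (cases "x \<in> Z") auto
    show "{x, par' x} \<in> insert {u, v} R" if "role' x = Pair" for x
      using that new_pair unchanged pair_red by (cases "x \<in> Z") auto
    show "role' (par' x) = Pair" if "role' x = Pair" for x
    proof (cases "x \<in> Z")
      case False
      then have "par x \<notin> Z"
        using Z_par[of "par x"] par_par pair_par that unchanged by metis
      then show ?thesis using False that unchanged pair_par by simp
    qed (use that new_pair in auto)
    show "card e = 2" if "e \<in> insert {u, v} R" for e
      using that new card_red by auto
  qed (use l used' finite_red all in \<open>auto simp: fits_def\<close>)
qed

lemma red_iso_iso:
  assumes "role u = Iso" "role v = Iso" "u \<noteq> v"
  shows "red_state l (role(u := Pair, v := Pair)) (par(u := v, v := u)) (insert {u, v} R)"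
  by (rule extend[where Z = "{u, v}"])
    (use assms red_iso in \<open>auto simp: fits_def total_credit_upd finitely_used_upd used insert_commute
      simp del: fun_upd_apply, auto\<close>)

lemma red_attach:
  assumes "role u = Iso" "\<not> small (role v)" "height r < height (role v)"
    "r = Leaf \<or> r = Tip"
  shows "red_state l (role(u := r)) (par(u := v)) (insert {u, v} R)"
proof (rule extend[where Z = "{u}"])
  have "u \<noteq> v" using assms by auto
  then show "fits l (role(u := r)) (par(u := v)) u v" "fits l (role(u := r)) (par(u := v)) v u" "u \<noteq> v"
    using assms by (auto simp: fits_def)
  show "total_credit l (role(u := r)) \<le> total_credit l role + 2 * l"
    using assms l by (auto simp: total_credit_upd used)
qed (use assms red_iso in \<open>auto simp: finitely_used_upd used simp del: fun_upd_apply, auto\<close>)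

text \<open>The new red P_3 is a core edge with a leaf for \<open>l = 5\<close> and a whole core
  with center \<open>v\<close> for \<open>l = 3\<close>. Either way the credit grows by exactly
  \<open>2 * l\<close>.\<close>

definition "base_iso_pair u v =
  (if l = 5 then role(v := Base, par v := Base, u := Leaf)
   else role(v := Center, par v := Base, u := Base))"

lemma red_iso_pair:
  assumes "role u = Iso" "role v = Pair"
  shows "red_state l (base_iso_pair u v) (par(u := v)) (insert {u, v} R)"
proof -
  define w where "w = par v"
  have pp: "role w = Pair" "par w = v" "par v = w"
    using assms pair_par par_par by (auto simp: w_def)
  have neq: "u \<noteq> v" "u \<noteq> w" "w \<noteq> v"
    using assms pp par_neq[of v] by auto
  note neq = neq neq[symmetric]
  define role' where "role' = base_iso_pair u v"
  have role': "role' u = (if l = 5 then Leaf else Base)" "role' w = Base"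
    "role' v = (if l = 5 then Base else Center)" "\<And>x. x \<notin> {u, v, w} \<Longrightarrow> role' x = role x"
    using neq pp by (auto simp: role'_def base_iso_pair_def)
  show ?thesis
    unfolding role'_def[symmetric]
  proof (rule extend[where Z = "{u, v, w}"])
    show "{u, v} \<notin> R" "u \<noteq> v" using red_iso assms neq by auto
    show "total_credit l role' \<le> total_credit l role + 2 * l"
      using assms neq pp l
      by (auto simp: role'_def base_iso_pair_def total_credit_upd finitely_used_upd used)
    show "finitely_used role'"
      by (simp add: role'_def base_iso_pair_def finitely_used_upd used)
    have f: "fits l role' (par(u := v)) u v" "fits l role' (par(u := v)) v u"
      "fits l role' (par(u := v)) v w" "fits l role' (par(u := v)) w v"
      unfolding fits_def using l by (auto simp: role'(1-3) neq pp)
    show "fits l role' (par(u := v)) u v" "fits l role' (par(u := v)) v u"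
      by (fact f)+
    fix x
    show "role' x = role x \<and> (par(u := v)) x = par x" if "x \<notin> {u, v, w}"
      using that role'(4) by simp
    show "small (role x)" if "x \<in> {u, v, w}"
      using that by (elim insertE emptyE) (simp_all add: assms(1,2) pp)
    show "par x \<in> {u, v, w}" if "x \<in> {u, v, w}" "role x = Pair"
      using that by (elim insertE emptyE) (simp_all add: pp assms(1))
    show "fits l role' (par(u := v)) x (par x)" if "x \<in> {u, v, w}" "role x = Pair"
      using that by (elim insertE emptyE) (simp_all add: f pp assms(1))
    have "role' x \<noteq> Pair" if "x \<in> {u, v, w}"
      using that by (elim insertE emptyE) (simp_all add: role'(1-3))
    then show "{x, (par(u := v)) x} = {u, v} \<and> role' ((par(u := v)) x) = Pair"
      if "x \<in> {u, v, w}" "role' x = Pair"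
      using that by blast
    show "role' x \<noteq> Center" if "x \<in> {u, v, w}" "l = 5"
      using that(1) by (elim insertE emptyE) (simp_all add: role'(1-3) that(2))
  qed
qed

text \<open>The two pairs form the path \<open>par u\<close>, \<open>u\<close>, \<open>v\<close>,
  \<open>par v\<close>. Its middle edge is the core for \<open>l = 5\<close>; for
  \<open>l = 3\<close> the first three vertices are the core and \<open>par v\<close> is a
  leaf.\<close>

definition "base_pair_pair u v =
  (if l = 5 then role(u := Base, v := Base, par u := Leaf, par v := Leaf)
   else role(u := Center, v := Base, par u := Base, par v := Leaf))"

lemma red_pair_pair:
  assumes "role u = Pair" "role v = Pair" "u \<noteq> v" "v \<noteq> par u"
  shows "red_state l (base_pair_pair u v) (par(u := v, v := u)) (insert {u, v} R)"
proof -
  define w where "w = par u"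
  define z where "z = par v"
  have pp: "role z = Pair" "par z = v" "par v = z" "role w = Pair" "par w = u" "par u = w"
    using assms pair_par par_par by (auto simp: w_def z_def)
  have neq: "u \<noteq> v" "u \<noteq> w" "u \<noteq> z" "v \<noteq> w" "v \<noteq> z" "w \<noteq> z"
    using assms pp par_neq by metis+
  note neq = neq neq[symmetric]
  define role' where "role' = base_pair_pair u v"
  have role': "role' u = (if l = 5 then Base else Center)" "role' w = (if l = 5 then Leaf else Base)"
    "role' v = Base" "role' z = Leaf" "\<And>x. x \<notin> {u, v, w, z} \<Longrightarrow> role' x = role x"
    using neq pp by (auto simp: role'_def base_pair_pair_def)
  show ?thesis
    unfolding role'_def[symmetric]
  proof (rule extend[where Z = "{u, v, w, z}"])
    show "{u, v} \<notin> R" "u \<noteq> v" using red_pair assms neq by auto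
    show "total_credit l role' \<le> total_credit l role + 2 * l"
    proof -
      note f1 = used
      note f2 = finitely_used_upd[OF f1]
      note f3 = finitely_used_upd[OF f2]
      note f4 = finitely_used_upd[OF f3]
      have upd: "total_credit l (role(u := a, v := b, w := c, z := d)) = total_credit l role
        + credit l a + credit l b + credit l c + credit l d - 4 * l" for a b c d
        unfolding total_credit_upd[OF f4] total_credit_upd[OF f3] total_credit_upd[OF f2]
          total_credit_upd[OF f1]
        using neq assms(1,2) pp(1,4) by simp
      show ?thesis
        using l upd[of Base Base Leaf Leaf] upd[of Center Base Base Leaf]
        by (auto simp: role'_def base_pair_pair_def pp simp del: fun_upd_apply)
    qed
    show "finitely_used role'"
      by (simp add: role'_def base_pair_pair_def finitely_used_upd used)
    have f: "fits l role' (par(u := v, v := u)) u v" "fits l role' (par(u := v, v := u)) v u"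
      "fits l role' (par(u := v, v := u)) u w" "fits l role' (par(u := v, v := u)) w u"
      "fits l role' (par(u := v, v := u)) v z" "fits l role' (par(u := v, v := u)) z v"
      unfolding fits_def using l by (auto simp: role'(1-4) neq pp)
    show "fits l role' (par(u := v, v := u)) u v" "fits l role' (par(u := v, v := u)) v u"
      by (fact f)+
    fix x
    show "role' x = role x \<and> (par(u := v, v := u)) x = par x" if "x \<notin> {u, v, w, z}"
      using that role'(5) by simp
    show "small (role x)" if "x \<in> {u, v, w, z}"
      using that by (elim insertE emptyE) (simp_all add: assms(1,2) pp)
    show "par x \<in> {u, v, w, z}" if "x \<in> {u, v, w, z}"
      using that by (elim insertE emptyE) (simp_all add: pp)
    show "fits l role' (par(u := v, v := u)) x (par x)" if "x \<in> {u, v, w, z}"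
      using that by (elim insertE emptyE) (simp_all only: f pp)
    have "role' x \<noteq> Pair" if "x \<in> {u, v, w, z}"
      using that by (elim insertE emptyE) (simp_all add: role'(1-4))
    then show "{x, (par(u := v, v := u)) x} = {u, v} \<and> role' ((par(u := v, v := u)) x) = Pair"
      if "x \<in> {u, v, w, z}" "role' x = Pair"
      using that by blast
    show "role' x \<noteq> Center" if "x \<in> {u, v, w, z}" "l = 5"
      using that(1) by (elim insertE emptyE) (simp_all add: role'(1-4) that(2))
  qed
qed

text \<open>The pair becomes a leaf with a tip below it. Both choices of labels have the same total
  credit; \<open>SLeaf\<close> and \<open>STip\<close> move one unit from the leaf to the
  tip.\<close>

lemma red_pair_core:
  assumes "role p = Pair" "core (role v)" "(r, s) = (Leaf, Tip) \<or> (r, s) = (SLeaf, STip)"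
  shows "red_state l (role(p := r, par p := s)) (par(p := v)) (insert {p, v} R)"
proof (rule extend[where Z = "{p, par p}"])
  have neq: "p \<noteq> par p" "p \<noteq> v" "v \<noteq> par p"
    using assms par_neq[of p] pair_par[of p] by auto
  note neq = neq neq[symmetric]
  have pp: "role (par p) = Pair" "par (par p) = p" using assms pair_par par_par by auto
  show "{p, v} \<notin> R" "p \<noteq> v" using red_pair assms neq by auto
  show "total_credit l (role(p := r, par p := s)) \<le> total_credit l role + 2 * l"
    using assms neq pp l
    by (auto simp: total_credit_upd finitely_used_upd used)
  show "finitely_used (role(p := r, par p := s))"
    by (simp add: finitely_used_upd used)
  have "2 \<le> height (role v)" "small r = False" "small s = False" "core r = False"
    using assms by (cases "role v"; auto)+
  then show "fits l (role(p := r, par p := s)) (par(p := v)) p v"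
    "fits l (role(p := r, par p := s)) (par(p := v)) v p"
    "\<And>x. x \<in> {p, par p} \<Longrightarrow> role x = Pair \<Longrightarrow> fits l (role(p := r, par p := s)) (par(p := v)) x (par x)"
    using assms neq pp by (auto simp: fits_def)
qed (use assms pair_par[of p] par_par[of p] par_neq[of p] in \<open>auto split: if_splits\<close>)

text \<open>Otherwise \<open>par y\<close> would be both \<open>x\<close> and
  \<open>z\<close>.\<close>

lemma red_triple: "{x, y} \<in> R \<Longrightarrow> {y, z} \<in> R \<Longrightarrow> x \<noteq> z \<Longrightarrow>
    height (role x) < height (role y) \<or> height (role z) < height (role y)"
  using par_eq[of y x] par_eq[of y z] by (metis insert_commute not_less)

end

section \<open>The blue graph: early blue edges and their invariant\<close>

text \<open>Early edges into a core are the ones that bring no toll, so \<open>pair_core\<close> has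
  to limit them.\<close>

definition core_out :: "(nat \<Rightarrow> role) \<Rightarrow> (nat \<times> nat) set \<Rightarrow> nat \<Rightarrow> nat set" where
  "core_out role D x = {z. (x, z) \<in> D \<and> core (role z)}"

text \<open>
  \<open>D\<close> collects the directed blue edges that led from a small vertex to a component with at least
  three vertices at the moment they were drawn.
\<close>

locale blue_state =
  fixes role :: "nat \<Rightarrow> role" and par :: "nat \<Rightarrow> nat" and D :: "(nat \<times> nat) set"
    and B :: "nat set set"
  assumes finite_blue: "finite B"
    and card_blue: "e \<in> B \<Longrightarrow> card e = 2"
    and early_blue: "(x, z) \<in> D \<Longrightarrow> {x, z} \<in> B"
    and early_big: "(x, z) \<in> D \<Longrightarrow> \<not> small (role z)"
    and early_asym: "(x, z) \<in> D \<Longrightarrow> (z, x) \<notin> D"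
    and small_early: "{x, z} \<in> B \<Longrightarrow> small (role x) \<Longrightarrow> (x, z) \<in> D"
    and iso_outer: "(x, z) \<in> D \<Longrightarrow> role x = Iso \<Longrightarrow> outer (role z)"
    and iso_leafy: "(x, y) \<in> D \<Longrightarrow> (x, z) \<in> D \<Longrightarrow> role x = Iso \<Longrightarrow>
      leafy (role y) \<Longrightarrow> leafy (role z) \<Longrightarrow> y = z"
    and tip_early: "role x = Tip \<Longrightarrow> (\<exists>z. (x, z) \<in> D \<and> outer (role z)) \<or> 2 \<le> card (D `` {x})"
    and split_early: "role x = SLeaf \<or> role x = STip \<Longrightarrow> D `` {x} \<noteq> {}"
    and pair_core: "role x = Pair \<Longrightarrow> core_out role D x = {} \<or> core_out role D (par x) = {} \<or>
      card (core_out role D x) \<le> 1 \<and> card (core_out role D (par x)) \<le> 1"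
begin

lemma finite_early: "finite D"
proof -
  have "finite (\<Union>B)" using finite_blue card_blue by (metis card.infinite finite_Union zero_neq_numeral)
  moreover have "D \<subseteq> \<Union>B \<times> \<Union>B" using early_blue by fast
  ultimately show ?thesis by (meson finite_SigmaI finite_subset)
qed

lemma finite_out: "finite (D `` {x})"
  using finite_early by (rule finite_Image)

text \<open>Targets of \<open>D\<close> are never small and keep their roles, so only conditions on
  the start of an early edge can change. A fresh pair consists of formerly isolated vertices, which
  have no edges into cores by \<open>iso_outer\<close>.\<close>

lemma relabel:
  assumes keep: "\<And>x. \<not> small (role x) \<Longrightarrow> role' x = role x"
    and new: "\<And>x. small (role x) \<Longrightarrow> role' x \<noteq> role x \<Longrightarrow>
      role' x \<in> {Center, Base, Leaf} \<or>
      role' x = Tip \<and> ((\<exists>z. (x, z) \<in> D \<and> outer (role z)) \<or> 2 \<le> card (D `` {x})) \<or>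
      role' x \<in> {SLeaf, STip} \<and> D `` {x} \<noteq> {} \<or>
      role x = Iso \<and> role' x = Pair \<and> role (par' x) = Iso"
    and par': "\<And>x. role x = Pair \<Longrightarrow> role' x = Pair \<Longrightarrow> par' x = par x"
  shows "blue_state role' par' D B"
proof -
  have target: "role' z = role z" if "(x, z) \<in> D" for x z
    using that early_big keep by blast
  have core_out: "core_out role' D = core_out role D"
    using target by (auto simp: core_out_def fun_eq_iff)
  have small': "small (role x)" if "small (role' x)" for x
    using that keep[of x] by metis
  have iso': "role x = Iso" if "role' x = Iso" for x
    using that new[of x] keep[of x] by fastforce
  have iso_core: "core_out role D x = {}" if "role x = Iso" for x
    using that iso_outer by (auto simp: core_out_def outer_def)
  show ?thesis
  proof
    fix x y z
    show "\<not> small (role' z)" if "(x, z) \<in> D" using that early_big target by simp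
    show "(x, z) \<in> D" if "{x, z} \<in> B" "small (role' x)" using that small_early small' by simp
    show "outer (role' z)" if "(x, z) \<in> D" "role' x = Iso" using that target iso' iso_outer by metis
    show "y = z" if "(x, y) \<in> D" "(x, z) \<in> D" "role' x = Iso" "leafy (role' y)" "leafy (role' z)"
      using that target iso' iso_leafy by metis
    show "(\<exists>z. (x, z) \<in> D \<and> outer (role' z)) \<or> 2 \<le> card (D `` {x})" if "role' x = Tip"
    proof (cases "role' x = role x")
      case False
      then have "small (role x)" using keep by blast
      with False that new[of x] show ?thesis using target by auto
    qed (use that tip_early[of x] target in auto)
    show "D `` {x} \<noteq> {}" if "role' x = SLeaf \<or> role' x = STip"
    proof (cases "role' x = role x")
      case False
      then have "small (role x)" using keep by blast
      with False that new[of x] show ?thesis by auto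
    qed (use that split_early[of x] in auto)
    show "core_out role' D x = {} \<or> core_out role' D (par' x) = {} \<or>
      card (core_out role' D x) \<le> 1 \<and> card (core_out role' D (par' x)) \<le> 1" if "role' x = Pair"
    proof (cases "role x = Pair")
      case True
      then show ?thesis using that par' pair_core core_out by simp
    next
      case False
      moreover have "small (role x)" using that small' by simp
      ultimately show ?thesis using that new[of x] iso_core core_out by auto
    qed
  qed (use finite_blue card_blue early_blue early_asym in auto)
qed

text \<open>Such an edge is not recorded in \<open>D\<close>, as \<open>small_early\<close> concerns
  small vertices only.\<close>

lemma blue_big:
  assumes "\<not> small (role u)" "\<not> small (role v)" "u \<noteq> v"
  shows "blue_state role par D (insert {u, v} B)"
proof
  show "(x, z) \<in> D" if "{x, z} \<in> insert {u, v} B" "small (role x)" for x z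
    using that assms small_early by (auto simp: doubleton_eq_iff)
  show "card e = 2" if "e \<in> insert {u, v} B" for e
    using that assms card_blue by auto
  show "finite (insert {u, v} B)" using finite_blue by simp
qed (fact early_big early_asym iso_outer iso_leafy tip_early split_early pair_core
      | use early_blue in blast)+

text \<open>Hypotheses \<open>iso\<close> and \<open>pair\<close> are Painter's conditions for
  choosing blue. In the second alternative of \<open>pair\<close> the new edge is the first one from
  \<open>u\<close>, so both counts in \<open>pair_core\<close> are at most one afterwards.\<close>

lemma blue_small:
  assumes u: "small (role u)" and v: "\<not> small (role v)"
    and iso: "role u = Iso \<Longrightarrow> outer (role v) \<and>
      (leafy (role v) \<longrightarrow> (\<forall>z. (u, z) \<in> D \<longrightarrow> \<not> leafy (role z)))"
    and pair: "role u = Pair \<Longrightarrow> core (role v) \<Longrightarrow>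
      D `` {par u} = {} \<or> D `` {u} = {} \<and> card (D `` {par u}) \<le> 1"
    and pp: "\<And>x. role x = Pair \<Longrightarrow> par (par x) = x \<and> par x \<noteq> x"
  shows "blue_state role par (insert (u, v) D) (insert {u, v} B)"
proof -
  let ?D = "insert (u, v) D"
  have neq: "u \<noteq> v" using u v by auto
  have out: "?D `` {x} = (if x = u then insert v (D `` {x}) else D `` {x})" for x
    by auto
  have co: "core_out role ?D x =
      (if x = u \<and> core (role v) then insert v (core_out role D x) else core_out role D x)" for x
    by (auto simp: core_out_def)
  have co_sub: "core_out role D x \<subseteq> D `` {x}" for x by (auto simp: core_out_def)
  have co_card: "card (core_out role D x) \<le> card (D `` {x})" for x
    using co_sub finite_out by (simp add: card_mono)
  have rev: "(v, u) \<notin> D" using u early_big by blast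
  show ?thesis
  proof
    fix x y z
    show "(x, z) \<in> ?D" if "{x, z} \<in> insert {u, v} B" "small (role x)"
      using that v small_early by (auto simp: doubleton_eq_iff)
    show "(z, x) \<notin> ?D" if "(x, z) \<in> ?D"
      using that early_asym rev neq by auto
    show "y = z" if "(x, y) \<in> ?D" "(x, z) \<in> ?D" "role x = Iso" "leafy (role y)" "leafy (role z)"
      using that iso iso_leafy by auto
    show "(\<exists>z. (x, z) \<in> ?D \<and> outer (role z)) \<or> 2 \<le> card (?D `` {x})" if "role x = Tip"
      using tip_early[OF that] that u out[of x] by auto
    show "?D `` {x} \<noteq> {}" if "role x = SLeaf \<or> role x = STip"
      using split_early[OF that] by auto
    show "core_out role ?D x = {} \<or> core_out role ?D (par x) = {} \<or>
      card (core_out role ?D x) \<le> 1 \<and> card (core_out role ?D (par x)) \<le> 1" if "role x = Pair"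
    proof (cases "core (role v) \<and> (x = u \<or> par x = u)")
      case False
      then show ?thesis using pair_core[OF that] unfolding co by auto
    next
      case True
      then have "role u = Pair" using u v pp that iso by (cases "role u") (auto simp: outer_def)
      define w where "w = par u"
      have "w \<noteq> u" using pp \<open>role u = Pair\<close> by (simp add: w_def)
      have xw: "x = u \<and> par x = w \<or> x = w \<and> par x = u" 
        using True that pp by (auto simp: w_def)
      have "core_out role D w = {} \<or> core_out role D u = {} \<and> card (core_out role D w) \<le> 1"
        using pair[OF \<open>role u = Pair\<close>] True co_sub co_card[of w] unfolding w_def[symmetric]
        by fastforce
      then have "core_out role ?D w = {} \<or> card (core_out role ?D u) \<le> 1 \<and> card (core_out role ?D w) \<le> 1"
        using \<open>w \<noteq> u\<close> by (auto simp: co)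
      then show ?thesis using xw by auto
    qed
  qed (use neq v iso finite_blue card_blue early_blue early_big iso_outer in auto)
qed

end

section \<open>Painter's answer to one move\<close>

locale painter_state = red_state l role par R + blue_state role par D B
  for l role par D R B
begin

text \<open>The case distinction is Painter's rule. The last hypothesis orients the edge: when an
  isolated vertex meets a pair, the isolated one is \<open>u\<close>.\<close>

lemma move_small:
  assumes "small (role u)" "u \<noteq> v" "{u, v} \<notin> R" "{u, v} \<notin> B" "role v = Iso \<Longrightarrow> role u = Iso"
  shows "(\<exists>role' par'. painter_state l role' par' D (insert {u, v} R) B)
    \<or> painter_state l role par (insert (u, v) D) R (insert {u, v} B)"
    (is "?red \<or> ?blue")
proof -
  have red: ?red if "red_state l role' par' (insert {u, v} R)" "blue_state role' par' D B" for role' par'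
    using that unfolding painter_state_def by blast
  have pp: "role x = Pair \<Longrightarrow> par (par x) = x \<and> par x \<noteq> x" for x
    using par_par par_neq by blast
  note blue_small' = blue_small[OF assms(1) _ _ _ pp]
  have blue: ?blue if "blue_state role par (insert (u, v) D) (insert {u, v} B)"
    using that red_state_axioms unfolding painter_state_def by blast
  consider "role u = Iso" "role v = Iso" | "role u = Iso" "role v = Pair"
    | "role u = Iso" "core (role v)" | "role u = Iso" "leafy (role v)"
    | "\<not> small (role v)" "outer (role v)" "role u = Iso \<Longrightarrow> \<not> leafy (role v)"
    | "role u = Pair" "role v = Pair" | "role u = Pair" "core (role v)"
    using assms(1,5) by (cases "role u"; cases "role v"; simp add: outer_def)
  then show ?thesis
  proof cases
    case 1
    have "blue_state (role(u := Pair, v := Pair)) (par(u := v, v := u)) D B"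
      by (rule relabel) (use 1 in auto)
    then show ?thesis
      by (intro disjI1 red[OF red_iso_iso[OF 1 assms(2)]])
  next
    case 2
    show ?thesis
      by (intro disjI1 red[OF red_iso_pair[OF 2]] relabel)
        (use 2 pair_par[of v] in \<open>auto simp: base_iso_pair_def split: if_splits\<close>)
  next
    case 3
    then have st: "red_state l (role(u := Leaf)) (par(u := v)) (insert {u, v} R)"
      by (intro red_attach) (cases "role v"; simp)+
    show ?thesis
      by (intro disjI1 red[OF st] relabel) (use 3 in \<open>auto split: if_splits\<close>)
  next
    case 4
    show ?thesis
    proof (cases "\<exists>z. (u, z) \<in> D \<and> leafy (role z)")
      case True
      \<comment> \<open>The earlier blue edge to a leaf is the one that \<open>tip_early\<close>
        demands, so \<open>u\<close> may become a tip.\<close>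
      then have tip: "\<exists>z. (u, z) \<in> D \<and> outer (role z)" using iso_outer 4 by blast
      have st: "red_state l (role(u := Tip)) (par(u := v)) (insert {u, v} R)"
        using 4 by (intro red_attach) (cases "role v"; simp)+
      have "blue_state (role(u := Tip)) (par(u := v)) D B"
        by (rule relabel) (auto simp: 4 tip)
      then show ?thesis
        by (intro disjI1 red[OF st])
    next
      case False
      have "\<not> small (role v)" "outer (role v)" using 4 by (cases "role v"; simp add: outer_def)+
      then show ?thesis
        using False 4 by (intro disjI2 blue blue_small') auto
    qed
  next
    case 5
    then show ?thesis by (intro disjI2 blue blue_small') (auto simp: outer_def)
  next
    case 6
    then have "v \<noteq> par u" using assms(3) red_pair by auto
    then show ?thesis
      by (intro disjI1 red[OF red_pair_pair[OF 6 assms(2)]] relabel)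
        (use 6 pair_par[of u] pair_par[of v] in \<open>auto simp: base_pair_pair_def split: if_splits\<close>)
  next
    case 7
    have nP: "par u \<noteq> u" "role (par u) = Pair" using par_neq pair_par 7 by auto
    \<comment> \<open>Blue while hypothesis \<open>pair\<close> of \<open>blue_small\<close> holds.
      Otherwise \<open>par u\<close> has an early edge, and either \<open>u\<close> has one too,
      which allows the split labels, or \<open>par u\<close> has two, which is enough for a
      tip.\<close>
    show ?thesis
    proof (cases "D `` {par u} = {} \<or> D `` {u} = {} \<and> card (D `` {par u}) \<le> 1")
      case True
      have "\<not> small (role v)" using 7 by (cases "role v"; simp)
      then have "blue_state role par (insert (u, v) D) (insert {u, v} B)"
        by (intro blue_small') (use True 7 in simp_all)
      then show ?thesis by (intro disjI2 blue)
    next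
      case False
      show ?thesis
      proof (cases "D `` {u} = {}")
        case True
        then have "2 \<le> card (D `` {par u})" using False by linarith
        then have "blue_state (role(u := Leaf, par u := Tip)) (par(u := v)) D B"
          by (intro relabel) (use 7 nP in \<open>auto split: if_splits\<close>)
        then show ?thesis
          using red[OF red_pair_core[OF 7, of Leaf Tip]] by simp
      next
        case ne1: False
        have ne2: "D `` {par u} \<noteq> {}" using False by blast
        have "blue_state (role(u := SLeaf, par u := STip)) (par(u := v)) D B"
          by (intro relabel) (use 7 nP ne1 ne2 in \<open>simp_all split: if_splits, auto\<close>)
        then show ?thesis
          using red[OF red_pair_core[OF 7, of SLeaf STip]] by simp
      qed
    qed
  qed
qed

end

text \<open>The labels and \<open>D\<close> are quantified away: the invariant depends on the two
  color classes only, and Painter need not remember labels.\<close>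

definition balanced :: "int \<Rightarrow> nat set set \<Rightarrow> nat set set \<Rightarrow> bool" where
  "balanced l R B \<longleftrightarrow> (\<exists>role par D. painter_state l role par D R B)"

lemma balanced_move:
  assumes "balanced l R B" "card e = 2" "e \<notin> R" "e \<notin> B"
  shows "balanced l (insert e R) B \<or> balanced l R (insert e B)"
proof -
  obtain role par D where "painter_state l role par D R B"
    using assms(1) unfolding balanced_def by blast
  then interpret painter_state l role par D R B .
  obtain u v where e: "e = {u, v}" "u \<noteq> v" using assms(2) by (meson card_2_iff)
  have flip: "{v, u} = {u, v}" by auto
  consider "small (role u)" "role v = Iso \<longrightarrow> role u = Iso" | "small (role v)" "role u = Iso \<longrightarrow> role v = Iso"
    | "\<not> small (role u)" "\<not> small (role v)"
    by (cases "role u"; cases "role v"; simp)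
  then show ?thesis
  proof cases
    case 1
    then show ?thesis using move_small[of u v] e assms(3,4) unfolding balanced_def by blast
  next
    case 2
    then show ?thesis using move_small[of v u] e assms(3,4) flip unfolding balanced_def by metis
  next
    case 3
    then have "painter_state l role par D R (insert e B)"
      using blue_big[of u v] e red_state_axioms unfolding painter_state_def by simp
    then show ?thesis unfolding balanced_def by blast
  qed
qed

lemma balanced_empty:
  assumes "l = 3 \<or> l = 5"
  shows "balanced l {} {}"
proof -
  have "painter_state l (\<lambda>_. Iso) (\<lambda>x. x) {} {} {}"
    by unfold_locales (use assms in \<open>auto simp: finitely_used_def total_credit_def\<close>)
  then show ?thesis unfolding balanced_def by blast
qed

section \<open>Length of red paths\<close>

text \<open>By \<open>red_triple\<close> the heights increase strictly, repeat at most once at the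
  top, then decrease strictly. The longest patterns are 0,1,2,2,1,0 for \<open>l = 5\<close> and, as
  \<open>flat\<close> forbids a repetition above 0, 0,1,2,3,2,1,0 for \<open>l = 3\<close>.\<close>

lemma (in red_state) no_long_red_path:
  assumes "if l = 5 then 7 \<le> k else 8 \<le> k"
  shows "\<not> contains_copy (path_graph k) R"
proof
  assume "contains_copy (path_graph k) R"
  then obtain f :: "nat \<Rightarrow> nat" where inj: "inj_on f {0..<k}"
    and copy: "\<forall>e\<in>{{i, Suc i} | i. Suc i < k}. f ` e \<in> R"
    by (auto simp: contains_copy_def path_graph_def)
  have edge: "{f i, f (Suc i)} \<in> R" if "Suc i < k" for i
  proof -
    have "f ` {i, Suc i} \<in> R" using copy that by blast
    then show ?thesis by simp
  qed
  define h where "h i = height (role (f i))" for i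
  have neq: "f i \<noteq> f (Suc (Suc i))" if "Suc (Suc i) < k" for i
    using inj_onD[OF inj, of i "Suc (Suc i)"] that by auto
  have peak: "h i < h (Suc i) \<or> h (Suc (Suc i)) < h (Suc i)" if "Suc (Suc i) < k" for i
    using red_triple[OF edge[of i] edge[of "Suc i"] neq[of i]] that by (simp add: h_def)
  have le: "h i \<le> 3" "l = 5 \<Longrightarrow> h i \<le> 2" for i
    using no_center[of "f i"] by (cases "role (f i)"; simp add: h_def)+
  have k: "7 \<le> k" using assms by (auto split: if_splits)
  have p: "h 0 < h 1 \<or> h 2 < h 1" "h 1 < h 2 \<or> h 3 < h 2" "h 2 < h 3 \<or> h 4 < h 3"
    "h 3 < h 4 \<or> h 5 < h 4" "h 4 < h 5 \<or> h 6 < h 5"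
    using k peak[of 0] peak[of 1] peak[of 2] peak[of 3] peak[of 4] by (simp_all add: eval_nat_numeral)
  show False
  proof (cases "l = 5")
    case True
    \<comment> \<open>The middle one of seven vertices has three strict descents to one side, hence
      height at least 3.\<close>
    then show False using p le(2)[of 3] by linarith
  next
    case False
    then have "8 \<le> k" using assms by simp
    then have p': "h 5 < h 6 \<or> h 7 < h 6" using peak[of 5] by (simp add: eval_nat_numeral)
    \<comment> \<open>Eight vertices force the heights 0,1,2,3,3,2,1,0, and \<open>flat\<close>
      excludes the equal pair in the middle.\<close>
    have "h 3 = h 4 \<Longrightarrow> h 3 = 0"
      using flat[OF edge[of 3]] k False by (auto simp: h_def)
    then show False using p p' le(1)[of 3] le(1)[of 4] by linarith
  qed
qed

section \<open>Discharging over a blue copy\<close>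

text \<open>
  Twice the difference between what the blue degree \<open>d\<close> of a vertex of the copy contributes to the
  number of rounds (with the bonus for degree one) and what the bound charges for the vertex;
  \<open>d = 0\<close> stands for a vertex outside the copy.
\<close>

definition weight :: "int \<Rightarrow> int \<Rightarrow> int" where
  "weight l d = (if d = 0 then 0 else l * d - (3 * l + 1) + (if d = 1 then 2 * l else 0))"

text \<open>One summand in parentheses is below \<open>- 1\<close> only for degree 2, where the
  weight is \<open>- l - 1\<close>. If both degrees are 2, the total is \<open>2 - c - c'\<close>,
  and the last hypothesis gives \<open>c + c' \<le> 2\<close>.\<close>

lemma weight_pair:
  assumes "l = 3 \<or> l = 5" "0 \<le> d" "0 \<le> d'" "c \<le> d" "c' \<le> d'"
    "c = 0 \<or> c' = 0 \<or> c \<le> 1 \<and> c' \<le> 1"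
  shows "0 \<le> 2 * l + (weight l d + d - c) + (weight l d' + d' - c')"
proof -
  have *: "weight l d + d - c \<ge> -1 \<or> d = 2 \<and> weight l d = - l - 1" if "0 \<le> d" "c \<le> d" for d c
    using that assms(1) by (auto simp: weight_def)
  show ?thesis
    using *[OF assms(2,4)] *[OF assms(3,5)] assms by auto
qed

text \<open>\<open>V\<close> and \<open>F\<close> are the vertices and edges of the copy. Blue edges
  outside \<open>F\<close>, even between vertices of \<open>V\<close>, are possible; the early ones
  are counted by \<open>extra\<close>.\<close>

locale blue_copy = painter_state l role par D R B for l role par D R B +
  fixes V :: "nat set" and F :: "nat set set"
  assumes finite_V: "finite V"
    and F_blue: "F \<subseteq> B"
    and F_V: "e \<in> F \<Longrightarrow> e \<subseteq> V"
    and covered: "x \<in> V \<Longrightarrow> \<exists>e\<in>F. x \<in> e"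
begin

definition deg :: "nat \<Rightarrow> nat" where
  "deg x = card {e \<in> F. x \<in> e}"

definition out :: "nat \<Rightarrow> nat set" where
  "out x = {z. (x, z) \<in> D \<and> {x, z} \<in> F}"

definition inc :: "nat \<Rightarrow> nat set" where
  "inc z = {x. (x, z) \<in> D \<and> {x, z} \<in> F}"

definition extra :: "nat \<Rightarrow> nat set" where
  "extra x = {z. (x, z) \<in> D \<and> {x, z} \<notin> F}"

definition received :: "nat \<Rightarrow> int" where
  "received x = (\<Sum>z\<in>out x. toll l (role z))"

definition paid :: "nat \<Rightarrow> int" where
  "paid z = toll l (role z) * int (card (inc z))"

text \<open>In these units a round is worth \<open>2 * l\<close>: a red edge pays for credit, an
  edge of \<open>F\<close> gives \<open>l\<close> to each end, and an early edge outside
  \<open>F\<close> goes wholly to its start.\<close>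

definition balance :: "nat \<Rightarrow> int" where
  "balance x = credit l (role x) + weight l (int (deg x)) + 2 * l * int (card (extra x))
     + received x - paid x"

lemma finite_F: "finite F"
  using F_blue finite_blue finite_subset by blast

lemma finite_deg: "finite {e \<in> F. x \<in> e}"
  using finite_F by simp

lemma finite_sets: "finite (out x)" "finite (inc x)" "finite (extra x)"
proof -
  have "out x \<subseteq> D `` {x}" "extra x \<subseteq> D `` {x}" "inc x \<subseteq> D\<inverse> `` {x}"
    by (auto simp: out_def extra_def inc_def)
  then show "finite (out x)" "finite (inc x)" "finite (extra x)"
    using finite_early by (meson finite_Image finite_converse finite_subset)+
qed

lemma deg_eq_0: "deg x = 0 \<longleftrightarrow> x \<notin> V"
proof -
  have "deg x = 0 \<longleftrightarrow> \<not> (\<exists>e\<in>F. x \<in> e)"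
    using finite_deg[of x] unfolding deg_def by auto
  then show ?thesis using covered F_V by blast
qed

lemma out_inc_le: "card (out x) + card (inc x) \<le> deg x"
proof -
  have "out x \<inter> inc x = {}" using early_asym by (auto simp: out_def inc_def)
  then have "card (out x) + card (inc x) = card (out x \<union> inc x)"
    using finite_sets by (simp add: card_Un_disjoint)
  also have "\<dots> = card ((\<lambda>z. {x, z}) ` (out x \<union> inc x))"
    by (subst card_image) (auto simp: inj_on_def doubleton_eq_iff)
  also have "\<dots> \<le> deg x"
    unfolding deg_def by (rule card_mono[OF finite_deg]) (auto simp: out_def inc_def insert_commute)
  finally show ?thesis .
qed

lemma card_out_extra: "card (D `` {x}) = card (out x) + card (extra x)"
proof -
  have "D `` {x} = out x \<union> extra x" "out x \<inter> extra x = {}" by (auto simp: out_def extra_def)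
  then show ?thesis using finite_sets by (simp add: card_Un_disjoint)
qed

lemma inc_small: "small (role x) \<Longrightarrow> inc x = {}"
  using early_big by (auto simp: inc_def)

text \<open>By \<open>small_early\<close>, all blue edges at a small vertex are early and leave
  it.\<close>

lemma deg_small:
  assumes "small (role x)"
  shows "deg x = card (out x)"
proof -
  have "{e \<in> F. x \<in> e} \<subseteq> (\<lambda>z. {x, z}) ` out x"
  proof
    fix e assume e: "e \<in> {e \<in> F. x \<in> e}"
    then have "card e = 2" using F_blue card_blue by blast
    then obtain z where "e = {x, z}" using e by (auto simp: card_2_iff)
    then show "e \<in> (\<lambda>z. {x, z}) ` out x"
      using e small_early assms F_blue by (auto simp: out_def)
  qed
  then have "deg x \<le> card (out x)"
    unfolding deg_def using finite_sets by (meson surj_card_le)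
  then show ?thesis using out_inc_le[of x] by simp
qed

lemma toll_nonneg: "0 \<le> toll l r"
  using l by (cases r) auto

lemma toll_outer: "outer r \<Longrightarrow> 1 \<le> toll l r"
  using l by (cases r) (auto simp: outer_def)

lemma received_nonneg: "0 \<le> received x"
  unfolding received_def by (simp add: sum_nonneg toll_nonneg)

lemma received_outer:
  assumes "z \<in> out x" "outer (role z)"
  shows "1 \<le> received x"
proof -
  have "toll l (role z) \<le> received x"
    unfolding received_def using assms(1) finite_sets by (intro member_le_sum) (auto simp: toll_nonneg)
  then show ?thesis using toll_outer[OF assms(2)] by simp
qed

text \<open>At most one edge goes to a leaf; the others go to tips and bring \<open>l\<close>
  each.\<close>

lemma received_iso:
  assumes "role x = Iso" "out x \<noteq> {}"
  shows "l * (int (card (out x)) - 1) + 1 \<le> received x"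
proof -
  \<comment> \<open>\<open>y\<close> is the only leaf among the targets, or any target if there is
    no leaf.\<close>
  obtain y where y: "y \<in> out x" "\<And>z. z \<in> out x \<Longrightarrow> z \<noteq> y \<Longrightarrow> \<not> leafy (role z)"
    using iso_leafy assms unfolding out_def by blast
  have o: "outer (role z)" if "z \<in> out x" for z
    using that iso_outer assms(1) by (auto simp: out_def)
  have "l \<le> toll l (role z)" if "z \<in> out x - {y}" for z
    using y(2)[of z] o[of z] that by (cases "role z") (auto simp: outer_def)
  then have "int (card (out x - {y})) * l \<le> (\<Sum>z\<in>out x - {y}. toll l (role z))"
    by (rule sum_bounded_below)
  moreover have "received x = toll l (role y) + (\<Sum>z\<in>out x - {y}. toll l (role z))"
    unfolding received_def using y finite_sets by (simp add: sum.remove)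
  moreover have "int (card (out x - {y})) = int (card (out x)) - 1"
    using card_Suc_Diff1[OF finite_sets(1) y(1)] by linarith
  ultimately show ?thesis using toll_outer[OF o[OF y(1)]] by (simp add: mult.commute)
qed

text \<open>An early edge that avoids cores ends at a leaf or a tip, which pays at least 1.\<close>

lemma received_pair:
  "int (card (out x)) - int (card (out x \<inter> core_out role D x)) \<le> received x"
proof -
  have o: "outer (role z)" if "z \<in> out x - core_out role D x" for z
    using that early_big by (auto simp: out_def core_out_def outer_def)
  have "int (card (out x)) - int (card (out x \<inter> core_out role D x))
      = int (card (out x - core_out role D x))"
    using finite_sets by (simp add: card_Diff_subset_Int card_mono of_nat_diff)
  also have "\<dots> \<le> (\<Sum>z\<in>out x - core_out role D x. toll l (role z))"
    using sum_bounded_below[of "out x - core_out role D x" 1 "\<lambda>z. toll l (role z)"] o toll_outer by simp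
  also have "\<dots> \<le> received x"
    unfolding received_def using finite_sets by (intro sum_mono2) (auto simp: toll_nonneg)
  finally show ?thesis .
qed

text \<open>Cores and leaves at worst break even at degree 2, isolated vertices at degrees 1 and 2.
  A tip that pays \<open>l\<close> on every edge lacks \<open>l + 1\<close> from degree 2 on. Its
  own early edge makes up for this: outside the copy it is worth \<open>2 * l\<close>; inside, it
  saves one toll of \<open>l\<close>, and the last unit comes from a toll received, from a second
  early edge or, for \<open>STip\<close>, from the larger credit.\<close>

lemma balance_nonneg:
  assumes "role x \<noteq> Pair"
  shows "0 \<le> balance x"
proof -
  define d where "d = int (deg x)"
  define a where "a = int (card (out x))"
  define b where "b = int (card (inc x))"
  define e where "e = int (card (extra x))"
  have abd: "0 \<le> a" "0 \<le> b" "0 \<le> e" "a + b \<le> d"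
    using out_inc_le[of x] by (simp_all add: a_def b_def d_def e_def)
  have Dx: "int (card (D `` {x})) = a + e"
    using card_out_extra by (simp add: a_def e_def)
  have ne: "1 \<le> a + e" if "D `` {x} \<noteq> {}"
    using that finite_out[of x] Dx by (metis card_gt_0_iff int_one_le_iff_zero_less of_nat_0_less_iff)
  have bal: "balance x = credit l (role x) + weight l d + 2 * l * e + received x - toll l (role x) * b"
    by (simp add: balance_def paid_def d_def b_def e_def)
  note r = received_nonneg[of x]
  show ?thesis
  proof (cases "role x")
    case Iso
    then have "d = a" "b = 0" using deg_small[of x] inc_small[of x] by (simp_all add: d_def a_def b_def)
    moreover have "l * (a - 1) + 1 \<le> received x" if "a \<noteq> 0"
      using received_iso[OF Iso] that unfolding a_def by fastforce
    ultimately show ?thesis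
      using l abd r bal Iso by (auto simp: weight_def split: if_splits)
  next
    case Tip
    have "1 \<le> e \<or> 2 \<le> a \<or> 1 \<le> a \<and> 1 \<le> received x"
      using tip_early[OF Tip]
    proof
      assume "\<exists>z. (x, z) \<in> D \<and> outer (role z)"
      then obtain z where z: "(x, z) \<in> D" "outer (role z)" by blast
      show ?thesis
      proof (cases "z \<in> out x")
        case True
        then have "1 \<le> a" using finite_sets unfolding a_def by (metis One_nat_def Suc_leI card_gt_0_iff empty_iff of_nat_1 of_nat_mono)
        then show ?thesis using received_outer[OF True z(2)] by simp
      next
        case False
        then have "z \<in> extra x" using z by (simp add: out_def extra_def)
        then have "1 \<le> e" using finite_sets unfolding e_def by (metis One_nat_def Suc_leI card_gt_0_iff empty_iff of_nat_1 of_nat_mono)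
        then show ?thesis by simp
      qed
    qed (use Dx in linarith)
    then show ?thesis
      using l abd r bal Tip by (auto simp: weight_def split: if_splits)
  next
    case STip
    then show ?thesis
      using l abd r bal ne split_early[of x] by (auto simp: weight_def split: if_splits)
  next
    case SLeaf
    then show ?thesis
      using l abd r bal ne split_early[of x] by (auto simp: weight_def split: if_splits)
  qed (use assms l abd r bal in \<open>auto simp: weight_def split: if_splits\<close>)
qed

text \<open>One vertex may fall short when it has two edges to cores. Its partner then has none, and
  the two are balanced jointly.\<close>

lemma balance_pair:
  assumes "role x = Pair"
  shows "0 \<le> balance x + balance (par x)"
proof -
  define c where "c y = card (out y \<inter> core_out role D y)" for y
  have lower: "l + (weight l (int (deg y)) + int (deg y) - int (c y)) \<le> balance y"
    if "role y = Pair" for y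
    using that received_pair[of y] deg_small[of y] l by (auto simp: balance_def paid_def c_def)
  have c_deg: "c y \<le> deg y" if "role y = Pair" for y
    unfolding c_def using deg_small[of y] that finite_sets by (simp add: card_mono)
  have fin: "finite (core_out role D y)" for y
    using finite_out[of y] by (rule finite_subset[rotated]) (auto simp: core_out_def)
  have c_core: "c y \<le> card (core_out role D y)" for y
    unfolding c_def using fin by (simp add: card_mono)
  have "int (c x) = 0 \<or> int (c (par x)) = 0 \<or> int (c x) \<le> 1 \<and> int (c (par x)) \<le> 1"
    using pair_core[OF assms] c_core[of x] c_core[of "par x"] by (auto simp: c_def)
  then show ?thesis
    using weight_pair[OF l, of "int (deg x)" "int (deg (par x))" "int (c x)" "int (c (par x))"]
      lower[OF assms] lower[OF pair_par[OF assms]] c_deg[OF assms] c_deg[OF pair_par[OF assms]]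
    by simp
qed

lemma sum_balance_pairs: "0 \<le> (\<Sum>x | role x = Pair. balance x)"
proof -
  \<comment> \<open>\<open>par\<close> is an involution on pairs, so summing the joint balances
    counts each vertex twice.\<close>
  have "(\<Sum>x | role x = Pair. balance (par x)) = (\<Sum>x | role x = Pair. balance x)"
    by (rule sum.reindex_bij_witness[of _ par par]) (auto simp: par_par pair_par)
  moreover have "0 \<le> (\<Sum>x | role x = Pair. balance x + balance (par x))"
    by (intro sum_nonneg) (auto simp: balance_pair)
  ultimately show ?thesis by (simp add: sum.distrib)
qed

text \<open>A finite set outside which all summands vanish. It contains both ends of every early
  edge, so tolls can be summed from either side.\<close>

definition verts :: "nat set" where
  "verts = V \<union> {x. role x \<noteq> Iso} \<union> fst ` D \<union> snd ` D"

lemma finite_verts: "finite verts"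
  using finite_V used finite_early by (auto simp: verts_def finitely_used_def)

lemma sum_balance: "0 \<le> (\<Sum>x\<in>verts. balance x)"
proof -
  have sub: "{x. role x = Pair} \<subseteq> verts" by (auto simp: verts_def)
  have "0 \<le> (\<Sum>x\<in>verts - {x. role x = Pair}. balance x)"
    by (intro sum_nonneg balance_nonneg) auto
  then show ?thesis
    using sum_balance_pairs sum.subset_diff[OF sub finite_verts, of balance] by simp
qed

lemma sum_deg: "(\<Sum>x\<in>V. deg x) = 2 * card F"
proof -
  have "(\<Sum>x\<in>V. deg x) = (\<Sum>x\<in>V. \<Sum>e\<in>{e \<in> F. x \<in> e}. 1)" by (simp add: deg_def)
  also have "\<dots> = (\<Sum>e\<in>F. \<Sum>x\<in>{x \<in> V. x \<in> e}. 1)"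
    by (rule sum.swap_restrict[OF finite_V finite_F])
  also have "\<dots> = (\<Sum>e\<in>F. 2)"
  proof (rule sum.cong)
    fix e assume e: "e \<in> F"
    then have "{x \<in> V. x \<in> e} = e" "card e = 2" using F_V F_blue card_blue by blast+
    then show "(\<Sum>x\<in>{x \<in> V. x \<in> e}. 1) = (2::nat)" by simp
  qed simp
  finally show ?thesis by simp
qed

lemma sum_weight:
  "(\<Sum>x\<in>verts. weight l (int (deg x)))
    = 2 * l * int (card F) - (3 * l + 1) * int (card V) + 2 * l * int (card {x \<in> V. deg x = 1})"
proof -
  have "(\<Sum>x\<in>verts. weight l (int (deg x))) = (\<Sum>x\<in>V. weight l (int (deg x)))"
    by (rule sum.mono_neutral_right[OF finite_verts])
      (use deg_eq_0 in \<open>auto simp: verts_def weight_def\<close>)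
  also have "\<dots> = (\<Sum>x\<in>V. l * int (deg x) - (3 * l + 1) + (if deg x = 1 then 2 * l else 0))"
    by (rule sum.cong) (use deg_eq_0 in \<open>auto simp: weight_def\<close>)
  also have "\<dots> = l * (\<Sum>x\<in>V. int (deg x)) - (3 * l + 1) * int (card V)
      + (\<Sum>x\<in>V. if deg x = 1 then 2 * l else 0)"
    by (simp add: sum.distrib sum_subtractf sum_distrib_left)
  also have "(\<Sum>x\<in>V. int (deg x)) = 2 * int (card F)"
    using sum_deg by (metis of_nat_mult of_nat_numeral of_nat_sum)
  also have "(\<Sum>x\<in>V. if deg x = 1 then 2 * l else 0) = 2 * l * int (card {x \<in> V. deg x = 1})"
    using finite_V by (simp add: sum.If_cases Int_def)
  finally show ?thesis by simp
qed

text \<open>By \<open>early_asym\<close> no edge is recorded in both directions, so ordered pairs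
  can be counted as edges.\<close>

lemma sum_extra: "(\<Sum>x\<in>verts. card (extra x)) \<le> card B - card F"
proof -
  have "(\<Sum>x\<in>verts. card (extra x)) = card (Sigma verts extra)"
    using finite_verts finite_sets by simp
  also have "\<dots> = card ((\<lambda>(x, z). {x, z}) ` Sigma verts extra)"
    by (subst card_image) (use early_asym in \<open>auto simp: inj_on_def doubleton_eq_iff extra_def\<close>)
  also have "\<dots> \<le> card (B - F)"
    using finite_blue early_blue by (intro card_mono) (auto simp: extra_def)
  also have "\<dots> = card B - card F"
    using F_blue finite_F by (simp add: card_Diff_subset)
  finally show ?thesis .
qed

lemma sum_received: "(\<Sum>x\<in>verts. received x) = (\<Sum>x\<in>verts. paid x)"
proof -
  have out: "out x = {z \<in> verts. (x, z) \<in> D \<and> {x, z} \<in> F}" for x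
    by (force simp: out_def verts_def)
  have inc: "inc z = {x \<in> verts. (x, z) \<in> D \<and> {x, z} \<in> F}" for z
    by (force simp: inc_def verts_def)
  have "(\<Sum>x\<in>verts. received x)
      = (\<Sum>z\<in>verts. \<Sum>x\<in>{x \<in> verts. (x, z) \<in> D \<and> {x, z} \<in> F}. toll l (role z))"
    unfolding received_def out by (rule sum.swap_restrict[OF finite_verts finite_verts])
  then show ?thesis by (simp add: paid_def inc mult.commute)
qed

lemma copy_bound:
  "(3 * l + 1) * int (card V)
    \<le> 2 * l * int (card R + card B) + 2 * l * int (card {x \<in> V. deg x = 1})"
proof -
  have credit: "(\<Sum>x\<in>verts. credit l (role x)) \<le> 2 * l * int (card R)"
  proof -
    have "{x. role x \<noteq> Iso} \<subseteq> verts" by (auto simp: verts_def)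
    then show ?thesis using credit_le total_credit_superset[OF finite_verts] by metis
  qed
  have "card F \<le> card B" using F_blue finite_blue by (simp add: card_mono)
  then have "int (\<Sum>x\<in>verts. card (extra x)) \<le> int (card B) - int (card F)"
    using sum_extra by linarith
  then have "2 * l * int (\<Sum>x\<in>verts. card (extra x)) \<le> 2 * l * (int (card B) - int (card F))"
    using l by (intro mult_left_mono) auto
  then have extra: "(\<Sum>x\<in>verts. 2 * l * int (card (extra x))) \<le> 2 * l * (int (card B) - int (card F))"
    by (simp add: sum_distrib_left)
  have "(\<Sum>x\<in>verts. balance x) = (\<Sum>x\<in>verts. credit l (role x))
      + (\<Sum>x\<in>verts. weight l (int (deg x))) + (\<Sum>x\<in>verts. 2 * l * int (card (extra x)))"
    using sum_received by (simp add: balance_def sum.distrib sum_subtractf)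
  then show ?thesis
    using sum_balance credit extra sum_weight by (simp add: algebra_simps)
qed

end

section \<open>From the invariant to the online Ramsey game\<close>

lemma balanced_copy_bound:
  fixes G :: "'a ugraph"
  assumes G: "finite_simple_graph G" "no_isolated_vertices G"
    and "balanced l R B" "contains_copy G B"
  shows "(3 * l + 1) * int (num_vertices G)
    \<le> 2 * l * int (card R + card B) + 2 * l * int (num_degree_one G)"
proof -
  obtain role par D where "painter_state l role par D R B"
    using assms(3) unfolding balanced_def by blast
  then interpret painter_state l role par D R B .
  obtain f :: "'a \<Rightarrow> nat" where inj: "inj_on f (vertex_set G)"
    and copy: "\<And>e. e \<in> edge_set G \<Longrightarrow> f ` e \<in> B"
    using assms(4) unfolding contains_copy_def by blast
  have finV: "finite (vertex_set G)" and sub: "\<And>e. e \<in> edge_set G \<Longrightarrow> e \<subseteq> vertex_set G"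
    using G(1) by (auto simp: finite_simple_graph_def)
  have edges: "{e \<in> (`) f ` edge_set G. f v \<in> e} = (`) f ` {e \<in> edge_set G. v \<in> e}"
    if "v \<in> vertex_set G" for v
  proof -
    have "f v \<in> f ` e \<longleftrightarrow> v \<in> e" if "e \<in> edge_set G" for e
      using \<open>v \<in> vertex_set G\<close> sub[OF that] inj by (simp add: inj_on_image_mem_iff)
    then show ?thesis by blast
  qed
  have deg: "card {e \<in> (`) f ` edge_set G. f v \<in> e} = vertex_degree G v"
    if "v \<in> vertex_set G" for v
  proof -
    have "inj_on ((`) f) {e \<in> edge_set G. v \<in> e}"
      by (rule inj_on_subset[OF inj_on_image_Pow[OF inj]]) (use sub in auto)
    then show ?thesis unfolding edges[OF that] vertex_degree_def by (rule card_image)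
  qed
  interpret blue_copy l role par D R B "f ` vertex_set G" "(`) f ` edge_set G"
  proof
    show "\<exists>e\<in>(`) f ` edge_set G. x \<in> e" if "x \<in> f ` vertex_set G" for x
    proof -
      obtain v where v: "v \<in> vertex_set G" "x = f v" using \<open>x \<in> f ` vertex_set G\<close> by blast
      then have "{e \<in> edge_set G. v \<in> e} \<noteq> {}"
        using G(2) unfolding no_isolated_vertices_def vertex_degree_def by (metis card.empty)
      then show ?thesis using v by auto
    qed
  qed (use finV copy sub in auto)
  have "{x \<in> f ` vertex_set G. card {e \<in> (`) f ` edge_set G. x \<in> e} = 1}
      = f ` {v \<in> vertex_set G. vertex_degree G v = 1}"
    using deg by auto
  then have "card {x \<in> f ` vertex_set G. deg x = 1} = num_degree_one G"
    using inj unfolding deg_def num_degree_one_def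
    by (simp add: card_image inj_on_subset)
  then show ?thesis
    using copy_bound inj by (simp add: num_vertices_def card_image)
qed

lemma color_class_snoc:
  "color_class c (h @ [(e, c')]) = (if c' = c then insert e (color_class c h) else color_class c h)"
  by (auto simp: color_class_def)

text \<open>An arbitrary history may list an edge in both colors; the disjoint sum counts it once
  for each.\<close>

lemma card_color_classes: "card (color_class Red h) + card (color_class Blue h) \<le> length h"
proof -
  have fin: "finite (color_class c h)" for c
    by (rule finite_subset[of _ "fst ` set h"]) (force simp: color_class_def)+
  have "card (color_class Red h) + card (color_class Blue h)
      = card (color_class Red h <+> color_class Blue h)"
    using fin by (simp add: card_Plus)
  also have "\<dots> \<le> card (set h)"
    by (rule card_inj_on_le[of "case_sum (\<lambda>e. (e, Red)) (\<lambda>e. (e, Blue))"])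
      (auto simp: inj_on_def color_class_def)
  also have "\<dots> \<le> length h" by (rule card_length)
  finally show ?thesis .
qed

lemma length_play_history: "length (play_history \<sigma> \<tau> n) = n"
  by (induction n) (simp_all add: Let_def)

text \<open>The factor is 8/5 for \<open>l = 5\<close> and 5/3 for \<open>l = 3\<close>. The real
  bound is rounded up in the proof, because game lengths are of type \<open>enat\<close>.\<close>

lemma online_size_ramsey_ge:
  fixes G :: "'a ugraph"
  assumes G: "finite_simple_graph G" "no_isolated_vertices G"
    and l: "l = 3 \<or> l = 5" and k: "if l = 5 then 7 \<le> k else 8 \<le> k"
  shows "ereal ((3 * real_of_int l + 1) / (2 * real_of_int l) * real (num_vertices G) - real (num_degree_one G))
    \<le> ereal_of_enat (online_size_ramsey (path_graph k) G)"
proof -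
  let ?x = "(3 * real_of_int l + 1) / (2 * real_of_int l) * real (num_vertices G) - real (num_degree_one G)"
  define good where "good h \<longleftrightarrow> balanced l (color_class Red h) (color_class Blue h)" for h
  \<comment> \<open>Any color that preserves the invariant will do. Where none exists the value is
    arbitrary; this never happens in a play against a legal Builder.\<close>
  define \<tau> where "\<tau> h e = (SOME c. good (h @ [(e, c)]))" for h e
  have "enat (nat \<lceil>?x\<rceil>) \<le> game_length (path_graph k) G \<sigma> \<tau>" if \<sigma>: "legal_builder \<sigma>" for \<sigma>
  proof -
    have play: "good (play_history \<sigma> \<tau> n)" for n
    proof (induction n)
      case 0
      then show ?case using balanced_empty[OF l] by (simp add: good_def color_class_def)
    next
      case (Suc n)
      let ?h = "play_history \<sigma> \<tau> n"
      have e: "card (\<sigma> ?h) = 2" "\<sigma> ?h \<notin> color_class c ?h" for c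
        using \<sigma> unfolding legal_builder_def complete_edges_def selected_edges_def color_class_def
        by force+
      have "good (?h @ [(\<sigma> ?h, Red)]) \<or> good (?h @ [(\<sigma> ?h, Blue)])"
        using balanced_move[OF Suc[unfolded good_def] e(1) e(2) e(2)]
        by (simp add: good_def color_class_snoc)
      then have "\<exists>c. good (?h @ [(\<sigma> ?h, c)])" by blast
      then have "good (?h @ [(\<sigma> ?h, \<tau> ?h (\<sigma> ?h))])"
        unfolding \<tau>_def[of ?h "\<sigma> ?h"] by (rule someI_ex)
      then show ?case by (simp add: Let_def)
    qed
    have "nat \<lceil>?x\<rceil> \<le> n" if over: "game_over (path_graph k) G (play_history \<sigma> \<tau> n)" for n
    proof -
      let ?h = "play_history \<sigma> \<tau> n"
      have bal: "balanced l (color_class Red ?h) (color_class Blue ?h)"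
        using play by (simp add: good_def)
      then have "\<not> contains_copy (path_graph k) (color_class Red ?h)"
        unfolding balanced_def painter_state_def using red_state.no_long_red_path k by blast
      then have "contains_copy G (color_class Blue ?h)"
        using over by (simp add: game_over_def)
      from balanced_copy_bound[OF G bal this]
      have "(3 * l + 1) * int (num_vertices G)
          \<le> 2 * l * int (card (color_class Red ?h) + card (color_class Blue ?h)) + 2 * l * int (num_degree_one G)" .
      also have "\<dots> \<le> 2 * l * int n + 2 * l * int (num_degree_one G)"
        using card_color_classes[of ?h] l by (auto simp: length_play_history)
      finally have "real_of_int ((3 * l + 1) * int (num_vertices G))
          \<le> real_of_int (2 * l * int n + 2 * l * int (num_degree_one G))"
        by (rule of_int_le_iff[THEN iffD2])
      then have "?x \<le> real n"
        using l by (auto simp: field_simps)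
      then show ?thesis by linarith
    qed
    then show ?thesis
      unfolding game_length_def by (intro INF_greatest) simp
  qed
  then have "enat (nat \<lceil>?x\<rceil>) \<le> online_size_ramsey (path_graph k) G"
    unfolding online_size_ramsey_def by (blast intro: INF_greatest SUP_upper2)
  then have "ereal_of_enat (enat (nat \<lceil>?x\<rceil>)) \<le> ereal_of_enat (online_size_ramsey (path_graph k) G)"
    by (simp only: ereal_of_enat_le_iff)
  moreover have "ereal ?x \<le> ereal_of_enat (enat (nat \<lceil>?x\<rceil>))"
    by (simp add: real_nat_ceiling_ge)
  ultimately show ?thesis by (rule order_trans[rotated])
qed

theorem theorem2:
  fixes G :: "'a ugraph"
  assumes "finite_simple_graph G"
    and "no_isolated_vertices G"
  shows "ereal_of_enat (online_size_ramsey (path_graph 7) G)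
           \<ge> ereal (8 / 5 * real (num_vertices G) - real (num_degree_one G))
       \<and> ereal_of_enat (online_size_ramsey (path_graph 8) G)
           \<ge> ereal (18 / 11 * real (num_vertices G) - real (num_degree_one G))
       \<and> ereal_of_enat (online_size_ramsey (path_graph 9) G)
           \<ge> ereal (5 / 3 * real (num_vertices G) - real (num_degree_one G))"
proof (intro conjI)
  note bound = online_size_ramsey_ge[OF assms]
  show "ereal (8 / 5 * real (num_vertices G) - real (num_degree_one G))
      \<le> ereal_of_enat (online_size_ramsey (path_graph 7) G)"
    using bound[of 5 7] by simp
  show "ereal (5 / 3 * real (num_vertices G) - real (num_degree_one G))
      \<le> ereal_of_enat (online_size_ramsey (path_graph 9) G)"
    using bound[of 3 9] by simp
  \<comment> \<open>Since 18/11 is below 5/3, the bound from the P_3 core, which already excludes a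
    red P_8, is stronger than required.\<close>
  have "ereal (18 / 11 * real (num_vertices G) - real (num_degree_one G))
      \<le> ereal (5 / 3 * real (num_vertices G) - real (num_degree_one G))"
    by simp
  also have "\<dots> \<le> ereal_of_enat (online_size_ramsey (path_graph 8) G)"
    using bound[of 3 8] by simp
  finally show "ereal (18 / 11 * real (num_vertices G) - real (num_degree_one G))
      \<le> ereal_of_enat (online_size_ramsey (path_graph 8) G)" .
qed

end
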